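(* Assume there exist vectors $\bar y_k\in\mathcal{Y}_k$ ($k=1,\dots,K$) and $\bar q_j\in\triangle$ ($j=1,\dots,J$) with $\sum_{k=1}^K \bar y_k>\sum_{j=1}^J\mathcal{N}_j\bar q_j$ componentwise. Then the minimization problem $$\min_{p\in\mathbb{R}^n_+} TER(p)$$ is solvable, and its set of solutions is exactly the set of equilibrium prices.
   Context: $\langle\cdot,\cdot\rangle$ is the standard inner product on $\mathbb{R}^n$; inequalities between vectors are componentwise; $\mathbb{R}^n_+$ is the nonnegative orthant; $\triangle=\{q\in\mathbb{R}^n: q^{(i)}\ge 0,\ \sum_{i=1}^n q^{(i)}=1\}$. Demand. There are $n$ products and $J$ types of consumers, with $\mathcal{N}_j>0$ consumers of type $j$. For type $j$ there is a vector of observable utilities $a_j\in\mathbb{R}^n$, a partition of $\{1,\dots,n\}$ into nonempty nests $N_{j1},\dots,N_{jL_j}$, and nest parameters $0<\mu_{j\ell}\le 1$. The expected revenue (nested logit surplus) of a type-$j$ consumer at prices $p$ is $$E_j(p)=\ln\left(\sum_{\ell=1}^{L_j}\Big(\sum_{i\in N_{j\ell}}e^{(a_j^{(i)}-p^{(i)})/\mu_{j\ell}}\Big)^{\mu_{j\ell}}\right),$$ and the expected demand is $x_j(p)=-\nabla E_j(p)\in\triangle$ (the vector of choice probabilities). Supply. There are $K$ suppliers. Supplier $k$ has a closed convex set $\mathcal{Y}_k\subset\mathbb{R}^n$ and cost function $c_k(y)=\hat c_k(y)+\Gamma_k\|y-\hat y_k\|_2^2$, where $\hat c_k:\mathbb{R}^n\to\mathbb{R}$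 is convex, $\Gamma_k>0$ and $\hat y_k\in\mathbb{R}^n$. Its profit is $\pi_k(p)=\max_{y\in\mathcal{Y}_k}\langle p,y\rangle-c_k(y)$, and its supply $y_k(p)$ is the unique maximizer. The total expected revenue function is $TER(p)=\sum_{k=1}^K\pi_k(p)+\sum_{j=1}^J\mathcal{N}_jE_j(p)$. A vector $p^\star\in\mathbb{R}^n$ is an equilibrium price if $p^\star\ge 0$, $\sum_{k=1}^K y_k(p^\star)-\sum_{j=1}^J\mathcal{N}_jx_j(p^\star)\ge 0$, and $\big\langle p^\star,\ \sum_{k=1}^K y_k(p^\star)-\sum_{j=1}^J\mathcal{N}_jx_j(p^\star)\big\rangle=0$. *)

theory Defs
  imports "HOL-Analysis.Analysis"
begin

definition prob_simplex :: "(real^'n) set" where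
  "prob_simplex = {q. 0 \<le> q \<and> (\<Sum>i\<in>UNIV. q $ i) = 1}"

definition gradient :: "('a::real_inner \<Rightarrow> real) \<Rightarrow> 'a \<Rightarrow> 'a" where
  "gradient f p = (THE D. GDERIV f p :> D)"

lemma gradient_eq:
  assumes "GDERIV f p :> D"
  shows "gradient f p = D"
  unfolding gradient_def
proof (rule the_equality)
  show "GDERIV f p :> D" by (fact assms)
next
  fix D' assume "GDERIV f p :> D'"
  then have "(\<lambda>h. h \<bullet> D') = (\<lambda>h. h \<bullet> D)"
    using assms unfolding gderiv_def by (rule has_derivative_unique)
  then have "\<forall>h. h \<bullet> D' = h \<bullet> D"
    unfolding fun_eq_iff .
  then show "D' = D"
    unfolding vector_eq_ldot .
qed

definition nest_partition :: "nat \<Rightarrow> (nat \<Rightarrow> 'n set) \<Rightarrow> bool" where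
  "nest_partition L nest \<longleftrightarrow>
     (\<forall>l\<in>{1..L}. nest l \<noteq> {}) \<and> disjoint_family_on nest {1..L} \<and> (\<Union>l\<in>{1..L}. nest l) = UNIV"

definition nested_logit_surplus ::
  "real^'n \<Rightarrow> nat \<Rightarrow> (nat \<Rightarrow> 'n set) \<Rightarrow> (nat \<Rightarrow> real) \<Rightarrow> real^'n \<Rightarrow> real" where
  "nested_logit_surplus a L nest \<mu> p =
     ln (\<Sum>l=1..L. (\<Sum>i\<in>nest l. exp ((a $ i - p $ i) / \<mu> l)) powr \<mu> l)"

definition demand :: "(real^'n \<Rightarrow> real) \<Rightarrow> real^'n \<Rightarrow> real^'n" where
  "demand E p = - gradient E p"

definition supplier_cost ::
  "(real^'n \<Rightarrow> real) \<Rightarrow> real \<Rightarrow> real^'n \<Rightarrow> real^'n \<Rightarrow> real" where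
  "supplier_cost chat \<Gamma> yhat y = chat y + \<Gamma> * (norm (y - yhat))\<^sup>2"

text \<open>The maximum in \<open>profit\<close> is attained, and at a unique point, whenever \<open>Y\<close> is nonempty,
  closed and convex and \<open>c\<close> is a \<open>supplier_cost\<close> with \<open>chat\<close> convex and \<open>\<Gamma> > 0\<close>.\<close>

definition profit :: "(real^'n) set \<Rightarrow> (real^'n \<Rightarrow> real) \<Rightarrow> real^'n \<Rightarrow> real" where
  "profit Y c p = (GREATEST v. v \<in> (\<lambda>y. p \<bullet> y - c y) ` Y)"

definition optimal_supply :: "(real^'n) set \<Rightarrow> (real^'n \<Rightarrow> real) \<Rightarrow> real^'n \<Rightarrow> real^'n" where
  "optimal_supply Y c p = (THE y. is_arg_max (\<lambda>y. p \<bullet> y - c y) (\<lambda>y. y \<in> Y) y)"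

text \<open>Below there are \<open>K\<close> suppliers with production sets \<open>Y k\<close> and cost functions \<open>c k\<close>, and
  \<open>J\<close> types of consumers, with \<open>\<N> j\<close> consumers of type \<open>j\<close>, whose expected revenue function
  is \<open>E j\<close>.\<close>

definition TER ::
  "nat \<Rightarrow> (nat \<Rightarrow> (real^'n) set) \<Rightarrow> (nat \<Rightarrow> real^'n \<Rightarrow> real) \<Rightarrow>
   nat \<Rightarrow> (nat \<Rightarrow> real) \<Rightarrow> (nat \<Rightarrow> real^'n \<Rightarrow> real) \<Rightarrow> real^'n \<Rightarrow> real" where
  "TER K Y c J \<N> E p = (\<Sum>k=1..K. profit (Y k) (c k) p) + (\<Sum>j=1..J. \<N> j * E j p)"

definition excess_supply ::
  "nat \<Rightarrow> (nat \<Rightarrow> (real^'n) set) \<Rightarrow> (nat \<Rightarrow> real^'n \<Rightarrow> real) \<Rightarrow>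
   nat \<Rightarrow> (nat \<Rightarrow> real) \<Rightarrow> (nat \<Rightarrow> real^'n \<Rightarrow> real) \<Rightarrow> real^'n \<Rightarrow> real^'n" where
  "excess_supply K Y c J \<N> E p =
     (\<Sum>k=1..K. optimal_supply (Y k) (c k) p) - (\<Sum>j=1..J. \<N> j *\<^sub>R demand (E j) p)"

definition equilibrium_price ::
  "nat \<Rightarrow> (nat \<Rightarrow> (real^'n) set) \<Rightarrow> (nat \<Rightarrow> real^'n \<Rightarrow> real) \<Rightarrow>
   nat \<Rightarrow> (nat \<Rightarrow> real) \<Rightarrow> (nat \<Rightarrow> real^'n \<Rightarrow> real) \<Rightarrow> real^'n \<Rightarrow> bool" where
  "equilibrium_price K Y c J \<N> E p \<longleftrightarrow>
     0 \<le> p \<and> 0 \<le> excess_supply K Y c J \<N> E p \<and> p \<bullet> excess_supply K Y c J \<N> E p = 0"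

end

theory Submission
  imports Defs
begin

text \<open>The total expected revenue is differentiable and lies above its tangent planes, and its
  gradient is the excess supply; the equilibrium conditions are therefore exactly the optimality
  conditions of its minimization over the orthant. A minimizer exists because testing each profit
  with \<open>ybar k\<close> and each surplus with \<open>qbar j\<close> bounds the revenue from below by an
  affine function with strictly positive slope.

  Both gradients are obtained from subgradients: for a profit, strong convexity of the cost adds a
  quadratic upper bound, and for a surplus, differentiability leaves only one possible
  subgradient.\<close>

section \<open>Gradients from subgradients and from quadratic bounds\<close>

text \<open>Subtracting the affine minorant leaves a differentiable function with a global minimum
  at \<open>p\<close>, so its derivative there vanishes.\<close>

lemma gderiv_of_subgradient:
  fixes f :: "'a::euclidean_space \<Rightarrow> real"
  assumes "f differentiable (at p)"
    and sub: "\<And>q. f q \<ge> f p + g \<bullet> (q - p)"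
  shows "GDERIV f p :> g"
proof -
  obtain D where D: "(f has_derivative D) (at p)"
    using assms(1) by (auto simp: differentiable_def)
  have "((\<lambda>q. f q - g \<bullet> (q - p)) has_derivative (\<lambda>h. D h - g \<bullet> h)) (at p)"
    by (auto intro!: derivative_eq_intros D)
  moreover have "f p - g \<bullet> (p - p) \<le> f q - g \<bullet> (q - p)" for q
    using sub[of q] by simp
  ultimately have "(\<lambda>h. D h - g \<bullet> h) = (\<lambda>h. 0)"
    using differential_zero_maxmin[of p UNIV] by auto
  then have "D = (\<lambda>h. h \<bullet> g)"
    by (simp add: fun_eq_iff inner_commute)
  with D show ?thesis by (simp add: gderiv_def)
qed

text \<open>The linearization error lies between 0 and a multiple of the squared distance, so after
  division by the distance it still tends to 0. Differentiability is a conclusion here, which suits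
  a function defined as a maximum.\<close>

lemma gderiv_of_quadratic_sandwich:
  fixes f :: "'a::real_inner \<Rightarrow> real"
  assumes lo: "\<And>q. f q \<ge> f p + g \<bullet> (q - p)"
    and up: "\<And>q. f q \<le> f p + g \<bullet> (q - p) + C * (norm (q - p))\<^sup>2"
  shows "GDERIV f p :> g"
  unfolding gderiv_def has_derivative_def
proof (intro conjI)
  show "bounded_linear (\<lambda>h. h \<bullet> g)" by (rule bounded_linear_inner_left)
  have *: "((\<lambda>q. C * norm (q - p)) \<longlongrightarrow> 0) (at p)"
    by (auto intro!: tendsto_eq_intros)
  have bd: "norm ((1 / norm (q - p)) *\<^sub>R (f q - f p - (q - p) \<bullet> g)) \<le> C * norm (q - p)"
    if "q \<noteq> p" for q
    using lo[of q] up[of q] that by (simp add: field_simps inner_commute power2_eq_square abs_if)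
  show "((\<lambda>q. (f q - f (Lim (at p) (\<lambda>x. x)) - (q - Lim (at p) (\<lambda>x. x)) \<bullet> g) /\<^sub>R 
      norm (q - Lim (at p) (\<lambda>x. x))) \<longlongrightarrow> 0) (at p)"
  \<comment> \<open>The derivative recovers its base point as a limit along \<open>at p\<close>.
    That limit is \<open>p\<close> only when the filter is nontrivial; along the trivial filter
    every limit statement holds.\<close>
  proof (cases "at p = bot")
    case False
    then have "Lim (at p) (\<lambda>x. x) = p" by (simp add: tendsto_Lim)
    then show ?thesis
      using bd by (intro Lim_null_comparison[OF _ *]) (auto simp: eventually_at_filter divide_inverse)
  qed simp
qed

lemma gderiv_sum:
  assumes "\<And>i. i \<in> I \<Longrightarrow> GDERIV (f i) p :> g i"
  shows "GDERIV (\<lambda>q. \<Sum>i\<in>I. f i q) p :> (\<Sum>i\<in>I. g i)"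
  using assms unfolding gderiv_def inner_sum_right by (rule has_derivative_sum)

lemma gderiv_cmult:
  assumes "GDERIV f p :> g"
  shows "GDERIV (\<lambda>q. c * f q) p :> c *\<^sub>R g"
  using assms unfolding gderiv_def inner_scaleR_right by (rule has_derivative_mult_right)

lemma gderiv_continuous: "GDERIV f p :> g \<Longrightarrow> isCont f p"
  unfolding gderiv_def by (rule has_derivative_continuous)

section \<open>Minimization over the nonnegative orthant\<close>

text \<open>If the slope along \<open>h\<close> were negative, \<open>f\<close> would drop strictly
  on a short initial piece of the segment from \<open>p\<close> to \<open>p + h\<close>, which lies
  in \<open>S\<close> by convexity.\<close>

lemma feasible_direction_nonneg:
  fixes f :: "'a::real_inner \<Rightarrow> real"
  assumes "convex S" "GDERIV f p :> g" "p \<in> S" "p + h \<in> S"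
    and min: "\<And>q. q \<in> S \<Longrightarrow> f p \<le> f q"
  shows "0 \<le> g \<bullet> h"
proof (rule ccontr)
  assume neg: "\<not> 0 \<le> g \<bullet> h"
  have f: "(f has_derivative (\<lambda>h. h \<bullet> g)) (at (p + 0 *\<^sub>R h))"
    using assms(2) by (simp add: gderiv_def)
  have "((\<lambda>t. f (p + t *\<^sub>R h)) has_derivative (\<lambda>t. (t *\<^sub>R h) \<bullet> g)) (at (0::real))"
    by (rule has_derivative_compose[where g = f and f = "\<lambda>t. p + t *\<^sub>R h", OF _ f])
      (auto intro!: derivative_eq_intros)
  then have "DERIV (\<lambda>t. f (p + t *\<^sub>R h)) 0 :> g \<bullet> h"
    by (simp add: has_field_derivative_def inner_commute mult_commute_abs)
  then obtain d where "d > 0" and d: "\<And>t. 0 < t \<Longrightarrow> t < d \<Longrightarrow> f (p + t *\<^sub>R h) < f p"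
    using DERIV_neg_dec_right[of "\<lambda>t. f (p + t *\<^sub>R h)" "g \<bullet> h" 0] neg by auto
  \<comment> \<open>Less than \<open>d\<close>, so that \<open>f\<close> decreases, and at most 1,
    so that the point stays on the segment.\<close>
  define t where "t = min (d/2) 1"
  have t: "0 < t" "t < d" "t \<le> 1" using \<open>d > 0\<close> by (auto simp: t_def)
  have "(1 - t) *\<^sub>R p + t *\<^sub>R (p + h) \<in> S"
    using t assms by (intro convexD) auto
  then have "p + t *\<^sub>R h \<in> S" by (simp add: algebra_simps)
  with min d t show False by force
qed

text \<open>Complementarity as first-order optimality: unit directions give the sign of
  \<open>g\<close>, and conversely the tangent plane at \<open>p\<close> is minimized over the
  orthant at \<open>p\<close> itself.\<close>

lemma arg_min_nonneg_orthant_iff: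
  fixes f :: "real^'n \<Rightarrow> real"
  assumes gd: "GDERIV f p :> g"
    and sub: "\<And>q. f q \<ge> f p + g \<bullet> (q - p)"
  shows "is_arg_min f (\<lambda>p. 0 \<le> p) p \<longleftrightarrow> 0 \<le> p \<and> 0 \<le> g \<and> p \<bullet> g = 0"
proof
  assume L: "is_arg_min f (\<lambda>p. 0 \<le> p) p"
  have cv: "convex {p :: real^'n. 0 \<le> p}"
    by (auto simp: convex_def less_eq_vec_def)
  have dir: "0 \<le> g \<bullet> h" if "0 \<le> p + h" for h
    using L that by (intro feasible_direction_nonneg[OF cv gd]) (auto simp: is_arg_min_linorder)
  have p0: "0 \<le> p" using L by (simp add: is_arg_min_def)
  have "0 \<le> g $ i" for i
  proof -
    have "0 \<le> p + axis i 1" using p0 by (simp add: less_eq_vec_def axis_def)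
    from dir[OF this] show ?thesis by (simp add: inner_axis)
  qed
  \<comment> \<open>The directions \<open>p\<close> and \<open>- p\<close> lead to twice
    \<open>p\<close> and to the origin, both feasible; together they force orthogonality.\<close>
  moreover have "0 \<le> g \<bullet> p" using p0 by (intro dir) (simp add: less_eq_vec_def)
  moreover have "0 \<le> g \<bullet> (- p)" by (intro dir) simp
  ultimately show "0 \<le> p \<and> 0 \<le> g \<and> p \<bullet> g = 0"
    using p0 by (simp add: less_eq_vec_def inner_commute)
next
  assume R: "0 \<le> p \<and> 0 \<le> g \<and> p \<bullet> g = 0"
  have "f p \<le> f q" if "0 \<le> q" for q
  proof -
    have "0 \<le> g \<bullet> q"
      using R that by (auto simp: inner_vec_def less_eq_vec_def intro!: sum_nonneg)
    with sub[of q] R show ?thesis by (simp add: inner_diff_right inner_commute)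
  qed
  with R show "is_arg_min f (\<lambda>p. 0 \<le> p) p" by (simp add: is_arg_min_linorder)
qed

text \<open>On the orthant the lower bound grows in every coordinate, so outside a large box
  \<open>f\<close> is at least \<open>f 0\<close>, and a minimizer over the box is global.\<close>

lemma arg_min_nonneg_orthant_exists:
  fixes f :: "real^'n \<Rightarrow> real"
  assumes cont: "continuous_on UNIV f"
    and pos: "\<And>i. 0 < v $ i"
    and lo: "\<And>p. f p \<ge> p \<bullet> v - C"
  shows "\<exists>p. is_arg_min f (\<lambda>p. 0 \<le> p) p"
proof -
  \<comment> \<open>Each summand is the threshold beyond which coordinate \<open>i\<close> alone
    pushes the lower bound up to \<open>f 0\<close>; the sum dominates all of them.\<close>
  define R where "R = (\<Sum>i\<in>UNIV. \<bar>f 0 + C\<bar> / v $ i)"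
  have Rc: "\<bar>f 0 + C\<bar> / v $ i \<le> R" for i
    unfolding R_def using pos by (intro member_le_sum) (auto simp: less_imp_le)
  have R0: "0 \<le> R"
    unfolding R_def using pos by (intro sum_nonneg) (auto simp: less_imp_le)
  let ?B = "cbox (0::real^'n) (\<chi> i. R)"
  have "0 \<in> ?B" using R0 by (simp add: mem_box_cart)
  moreover have "continuous_on ?B f"
    using cont by (rule continuous_on_subset) simp
  ultimately obtain p where p: "p \<in> ?B" "\<And>q. q \<in> ?B \<Longrightarrow> f p \<le> f q"
    using continuous_attains_inf[OF compact_cbox, of 0 "\<chi> i. R" f] by (metis empty_iff)
  have "f p \<le> f q" if "0 \<le> q" for q
  proof (cases "q \<in> ?B")
    case False
    with that obtain i where i: "R < q $ i"
      by (auto simp: mem_box_cart less_eq_vec_def not_le)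
    have "\<bar>f 0 + C\<bar> \<le> R * v $ i" using Rc[of i] pos[of i] by (simp add: field_simps)
    also have "\<dots> \<le> q $ i * v $ i" using i pos[of i] by (simp add: mult_right_mono)
    also have "\<dots> \<le> q \<bullet> v"
      unfolding inner_vec_def inner_real_def
      using that pos by (intro member_le_sum) (auto simp: less_eq_vec_def less_imp_le)
    finally have "f 0 \<le> f q" using lo[of q] by linarith
    then show ?thesis using p(2)[of 0] \<open>0 \<in> ?B\<close> by linarith
  qed (rule p(2))
  moreover have "0 \<le> p" using p(1) by (simp add: mem_box_cart less_eq_vec_def)
  ultimately show ?thesis by (auto simp: is_arg_min_linorder)
qed

section \<open>Suppliers: existence, uniqueness and the gradient of the profit\<close>

lemma supplier_objective_strongly_concave:
  fixes chat :: "real^'n \<Rightarrow> real" and \<Gamma> yhat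
  assumes "convex_on UNIV chat" "0 \<le> t" "t \<le> 1"
  defines "\<phi> \<equiv> \<lambda>p y. p \<bullet> y - supplier_cost chat \<Gamma> yhat y"
  shows "\<phi> p ((1 - t) *\<^sub>R y + t *\<^sub>R z)
    \<ge> (1 - t) * \<phi> p y + t * \<phi> p z + \<Gamma> * (t * (1 - t) * (norm (y - z))\<^sup>2)"
proof -
  have cvx: "chat ((1 - t) *\<^sub>R y + t *\<^sub>R z) \<le> (1 - t) * chat y + t * chat z"
    using assms by (intro convex_onD) auto
  have sq: "(norm ((1 - t) *\<^sub>R y + t *\<^sub>R z - yhat))\<^sup>2
      = (1 - t) * (norm (y - yhat))\<^sup>2 + t * (norm (z - yhat))\<^sup>2 - t * (1 - t) * (norm (y - z))\<^sup>2"
    by (simp add: power2_norm_eq_inner inner_simps inner_commute algebra_simps)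
  show ?thesis
    unfolding \<phi>_def supplier_cost_def sq
    using cvx by (simp add: inner_simps algebra_simps)
qed

text \<open>\<open>Y\<close> may be unbounded, so compactness is replaced by strong concavity: far
  from \<open>y0\<close> the quadratic term outweighs any gain that could be visible near
  \<open>y0\<close>.\<close>

lemma supplier_maximum_exists:
  fixes chat :: "real^'n \<Rightarrow> real"
  assumes Y: "closed Y" "convex Y" "y0 \<in> Y"
    and chat: "convex_on UNIV chat" and \<Gamma>: "0 < \<Gamma>"
  shows "\<exists>y\<in>Y. \<forall>z\<in>Y. p \<bullet> z - supplier_cost chat \<Gamma> yhat z \<le> p \<bullet> y - supplier_cost chat \<Gamma> yhat y"
proof -
  define \<phi> where "\<phi> y = p \<bullet> y - supplier_cost chat \<Gamma> yhat y" for y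
  have "continuous_on UNIV chat"
    using chat by (intro convex_on_continuous) auto
  then have cont: "continuous_on S \<phi>" for S
    unfolding \<phi>_def supplier_cost_def
    by (auto intro!: continuous_intros intro: continuous_on_subset)
  have att: "\<exists>y\<in>Y \<inter> cball y0 r. \<forall>z\<in>Y \<inter> cball y0 r. \<phi> z \<le> \<phi> y" if "0 \<le> r" for r
    using that Y by (intro continuous_attains_sup cont closed_Int_compact) auto
  obtain m where m: "\<And>z. z \<in> Y \<inter> cball y0 1 \<Longrightarrow> \<phi> z \<le> \<phi> m"
    using att[OF zero_le_one] by blast
  \<comment> \<open>Chosen so that \<open>\<Gamma> * (R - 1)\<close> equals the largest possible
    change of \<open>\<phi>\<close> from \<open>y0\<close> to \<open>m\<close>, the bound over the
    unit ball.\<close>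
  define R where "R = 1 + \<bar>\<phi> m - \<phi> y0\<bar> / \<Gamma>"
  have R1: "1 \<le> R" using \<Gamma> by (simp add: R_def)
  have far: "\<phi> z \<le> \<phi> y0" if z: "z \<in> Y" "z \<notin> cball y0 R" for z
  proof -
    define r where "r = norm (y0 - z)"
    have r: "R < r" using z by (simp add: r_def dist_norm)
    then have r1: "1 < r" using R1 by simp
    \<comment> \<open>The point at distance 1 from \<open>y0\<close> towards \<open>z\<close>. There
      \<open>\<phi>\<close> is at most \<open>\<phi> m\<close>, while strong concavity adds
      \<open>\<Gamma> * (r - 1)\<close>, which leaves no room for \<open>\<phi> z\<close> above
      \<open>\<phi> y0\<close>.\<close>
    define w where "w = (1 - 1/r) *\<^sub>R y0 + (1/r) *\<^sub>R z"
    have "w \<in> Y" unfolding w_def using Y z r1 by (intro convexD) auto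
    moreover have "y0 - w = (1/r) *\<^sub>R (y0 - z)" by (simp add: w_def algebra_simps)
    then have "norm (y0 - w) = (1/r) * r" using r1 by (simp add: r_def)
    then have "w \<in> cball y0 1" using r1 by (simp add: dist_norm)
    ultimately have "\<phi> w \<le> \<phi> m" by (intro m) auto
    moreover have "\<phi> w \<ge> (1 - 1/r) * \<phi> y0 + (1/r) * \<phi> z + \<Gamma> * ((1/r) * (1 - 1/r) * r\<^sup>2)"
      unfolding w_def \<phi>_def r_def
      by (rule supplier_objective_strongly_concave) (use chat r1 in \<open>auto simp: r_def divide_le_eq_1\<close>)
    moreover have eq: "(1/r) * (1 - 1/r) * r\<^sup>2 = r - 1"
      using r1 by (simp add: field_simps power2_eq_square)
    moreover have "\<bar>\<phi> m - \<phi> y0\<bar> \<le> \<Gamma> * (r - 1)"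
      using r \<Gamma> by (simp add: R_def field_simps)
    moreover have "(1 - 1/r) * \<phi> y0 + (1/r) * \<phi> z = \<phi> y0 + (1/r) * (\<phi> z - \<phi> y0)"
      by (simp add: algebra_simps)
    ultimately have "(1/r) * (\<phi> z - \<phi> y0) \<le> 0" unfolding eq by linarith
    then show ?thesis using r1 by (simp add: field_simps)
  qed
  obtain y where y: "y \<in> Y" "\<And>z. z \<in> Y \<inter> cball y0 R \<Longrightarrow> \<phi> z \<le> \<phi> y"
    using att[of R] R1 by auto
  have "\<phi> z \<le> \<phi> y" if "z \<in> Y" for z
  proof (cases "z \<in> cball y0 R")
    case True with y that show ?thesis by auto
  next
    case False
    with far that have "\<phi> z \<le> \<phi> y0" by auto
    also have "\<phi> y0 \<le> \<phi> y" using Y R1 by (intro y) auto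
    finally show ?thesis .
  qed
  with y(1) show ?thesis unfolding \<phi>_def by blast
qed

text \<open>Strong concavity at the midpoint of \<open>y\<close> and \<open>z\<close>, where the
  objective cannot exceed its maximum; this choice produces the factor one half.\<close>

lemma supplier_quadratic_growth:
  fixes chat :: "real^'n \<Rightarrow> real"
  assumes "convex Y" and chat: "convex_on UNIV chat" and "y \<in> Y" "z \<in> Y"
    and max: "\<And>z. z \<in> Y \<Longrightarrow>
      p \<bullet> z - supplier_cost chat \<Gamma> yhat z \<le> p \<bullet> y - supplier_cost chat \<Gamma> yhat y"
  shows "p \<bullet> z - supplier_cost chat \<Gamma> yhat z
    \<le> p \<bullet> y - supplier_cost chat \<Gamma> yhat y - \<Gamma> / 2 * (norm (z - y))\<^sup>2"
proof -
  have "(1 - 1/2) *\<^sub>R y + (1/2) *\<^sub>R z \<in> Y"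
    using assms by (intro convexD) auto
  note max[OF this]
  moreover note supplier_objective_strongly_concave[OF chat, where t = "1/2" and p = p
    and y = y and z = z and \<Gamma> = \<Gamma> and yhat = yhat]
  ultimately show ?thesis by (simp add: norm_minus_commute field_simps)
qed

text \<open>Gives meaning to the definite description and the \<open>GREATEST\<close> in the
  definitions: quadratic growth forces any second maximizer to coincide with the first.\<close>

lemma optimal_supply:
  fixes chat :: "real^'n \<Rightarrow> real" and Y yhat \<Gamma>
  defines "c \<equiv> supplier_cost chat \<Gamma> yhat"
  assumes Y: "closed Y" "convex Y" "Y \<noteq> {}"
    and chat: "convex_on UNIV chat" and \<Gamma>: "0 < \<Gamma>"
  shows "optimal_supply Y c p \<in> Y"
    and "profit Y c p = p \<bullet> optimal_supply Y c p - c (optimal_supply Y c p)"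
    and "z \<in> Y \<Longrightarrow> p \<bullet> z - c z \<le> profit Y c p - \<Gamma> / 2 * (norm (z - optimal_supply Y c p))\<^sup>2"
proof -
  obtain y where y: "y \<in> Y" "\<And>z. z \<in> Y \<Longrightarrow> p \<bullet> z - c z \<le> p \<bullet> y - c y"
    using supplier_maximum_exists[OF Y(1,2) _ chat \<Gamma>, of _ p yhat] Y(3) unfolding c_def by blast
  have growth: "p \<bullet> z - c z \<le> p \<bullet> y - c y - \<Gamma> / 2 * (norm (z - y))\<^sup>2" if "z \<in> Y" for z
    unfolding c_def using Y(2) chat y that
    by (intro supplier_quadratic_growth) (auto simp: c_def)
  have os: "optimal_supply Y c p = y"
    unfolding optimal_supply_def
  proof (rule the_equality)
    show "is_arg_max (\<lambda>y. p \<bullet> y - c y) (\<lambda>y. y \<in> Y) y"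
      using y by (simp add: is_arg_max_linorder)
  next
    fix z assume "is_arg_max (\<lambda>y. p \<bullet> y - c y) (\<lambda>y. y \<in> Y) z"
    then have z: "z \<in> Y" "p \<bullet> y - c y \<le> p \<bullet> z - c z" using y by (auto simp: is_arg_max_linorder)
    with growth[of z] have "\<Gamma> * (norm (z - y))\<^sup>2 \<le> 0" by simp
    with \<Gamma> show "z = y" by (simp add: mult_le_0_iff)
  qed
  have pr: "profit Y c p = p \<bullet> y - c y"
    unfolding profit_def using y by (intro Greatest_equality) auto
  show "optimal_supply Y c p \<in> Y"
    and "profit Y c p = p \<bullet> optimal_supply Y c p - c (optimal_supply Y c p)"
    and "z \<in> Y \<Longrightarrow> p \<bullet> z - c z \<le> profit Y c p - \<Gamma> / 2 * (norm (z - optimal_supply Y c p))\<^sup>2"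
    using y growth by (auto simp: os pr)
qed

lemma profit_ge:
  fixes chat :: "real^'n \<Rightarrow> real" and Y yhat \<Gamma>
  defines "c \<equiv> supplier_cost chat \<Gamma> yhat"
  assumes "closed Y" "convex Y" "convex_on UNIV chat" "0 < \<Gamma>" "z \<in> Y"
  shows "p \<bullet> z - c z \<le> profit Y c p"
proof -
  have "0 \<le> \<Gamma> / 2 * (norm (z - optimal_supply Y c p))\<^sup>2" using assms by simp
  then show ?thesis
    using optimal_supply(3)[OF assms(2,3) _ assms(4-6), where p = p and yhat = yhat, folded c_def] assms(6)
    by fastforce
qed

text \<open>The supply at \<open>p\<close> remains feasible at price \<open>q\<close>, which gives
  the tangent plane as lower bound. For the upper bound, quadratic growth at \<open>p\<close>
  penalizes the move of the supply.\<close>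

lemma
  fixes chat :: "real^'n \<Rightarrow> real" and Y yhat \<Gamma>
  defines "c \<equiv> supplier_cost chat \<Gamma> yhat"
  assumes "closed Y" "convex Y" "Y \<noteq> {}" "convex_on UNIV chat" "0 < \<Gamma>"
  shows profit_subgradient:
      "profit Y c q \<ge> profit Y c p + optimal_supply Y c p \<bullet> (q - p)"
    and profit_gderiv: "GDERIV (profit Y c) p :> optimal_supply Y c p"
proof -
  let ?y = "optimal_supply Y c"
  note os = optimal_supply[OF assms(2-6), where yhat = yhat, folded c_def]
  have lo: "profit Y c q \<ge> profit Y c p + ?y p \<bullet> (q - p)" for q
    using profit_ge[OF assms(2,3,5,6) os(1), where p = q and yhat = yhat, folded c_def] os(2)[of p]
    by (simp add: inner_simps inner_commute)
  show "profit Y c q \<ge> profit Y c p + ?y p \<bullet> (q - p)" by (rule lo)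
  have up: "profit Y c q \<le> profit Y c p + ?y p \<bullet> (q - p) + 1 / (2 * \<Gamma>) * (norm (q - p))\<^sup>2" for q
  proof -
    let ?d = "?y q - ?y p"
    \<comment> \<open>Splits the optimal value at \<open>q\<close> into the objective at the old
      price, the tangent term and a mixed term in the two displacements.\<close>
    have "profit Y c q = (p \<bullet> ?y q - c (?y q)) + ?y p \<bullet> (q - p) + (q - p) \<bullet> ?d"
      by (simp add: os(2)[of q] inner_simps inner_commute)
    also have "p \<bullet> ?y q - c (?y q) \<le> profit Y c p - \<Gamma> / 2 * (norm ?d)\<^sup>2"
      by (rule os(3)[OF os(1)])
    also have "(q - p) \<bullet> ?d \<le> norm (q - p) * norm ?d" by (rule norm_cauchy_schwarz)
    also have "\<dots> \<le> \<Gamma> / 2 * (norm ?d)\<^sup>2 + 1 / (2 * \<Gamma>) * (norm (q - p))\<^sup>2"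
    proof -
      \<comment> \<open>Young's inequality, weighted so that the supply displacement cancels against
        the growth term exactly.\<close>
      have "0 \<le> (\<Gamma> * norm ?d - norm (q - p))\<^sup>2 / (2 * \<Gamma>)" using assms(6) by simp
      also have "\<dots> = \<Gamma> / 2 * (norm ?d)\<^sup>2 + 1 / (2 * \<Gamma>) * (norm (q - p))\<^sup>2 - norm (q - p) * norm ?d"
        using assms(6) by (simp add: power2_eq_square field_simps)
      finally show ?thesis by simp
    qed
    finally show ?thesis by simp
  qed
  show "GDERIV (profit Y c) p :> ?y p"
    by (rule gderiv_of_quadratic_sandwich[OF lo up])
qed

section \<open>Consumers: bounds and gradient of the nested logit surplus\<close>

lemma ln_weighted_sum_ge:
  fixes w x :: "'a \<Rightarrow> real"
  assumes "finite I" "(\<Sum>i\<in>I. w i) = 1" "\<And>i. i \<in> I \<Longrightarrow> 0 \<le> w i" "\<And>i. i \<in> I \<Longrightarrow> 0 < x i"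
  shows "(\<Sum>i\<in>I. w i * ln (x i)) \<le> ln (\<Sum>i\<in>I. w i * x i)"
proof -
  have "I \<noteq> {}" using assms(2) by auto
  have "(\<Sum>i\<in>I. w i * ln (x i)) \<le> ln (\<Sum>i\<in>I. w i *\<^sub>R x i)"
    using assms \<open>I \<noteq> {}\<close> by (intro concave_on_sum[OF _ _ ln_concave]) auto
  then show ?thesis by simp
qed

context
  fixes a :: "real^'n" and L :: nat and nest :: "nat \<Rightarrow> 'n set" and \<mu> :: "nat \<Rightarrow> real"
  assumes part: "nest_partition L nest"
    and \<mu>: "\<And>l. l \<in> {1..L} \<Longrightarrow> 0 < \<mu> l"
begin

abbreviation "nest_sum p l \<equiv> \<Sum>i\<in>nest l. exp ((a $ i - p $ i) / \<mu> l)"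
abbreviation "nest_total p \<equiv> \<Sum>l=1..L. nest_sum p l powr \<mu> l"

lemma nest_sum_pos: "l \<in> {1..L} \<Longrightarrow> 0 < nest_sum p l"
  using part by (intro sum_pos) (auto simp: nest_partition_def)

lemma nest_total_pos: "0 < nest_total p"
proof -
  \<comment> \<open>The nests cover a nonempty type, so there is at least one nest and the outer sum
    is not empty.\<close>
  have "(\<Union>l\<in>{1..L}. nest l) \<noteq> {}" using part by (simp add: nest_partition_def)
  then have "{1..L} \<noteq> {}" by blast
  moreover have "0 < nest_sum p l powr \<mu> l" if "l \<in> {1..L}" for l
    using nest_sum_pos[OF that, of p] by simp
  ultimately show ?thesis by (intro sum_pos) auto
qed

text \<open>All terms but the one of product \<open>i\<close> are dropped; the outer power then
  undoes the division by \<open>\<mu> l\<close>.\<close>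

lemma nested_logit_surplus_ge: "a $ i - p $ i \<le> nested_logit_surplus a L nest \<mu> p"
proof -
  have "i \<in> (\<Union>l\<in>{1..L}. nest l)" using part by (simp add: nest_partition_def)
  then obtain l where l: "l \<in> {1..L}" "i \<in> nest l" by blast
  have "exp (a $ i - p $ i) = exp ((a $ i - p $ i) / \<mu> l) powr \<mu> l"
    using \<mu>[OF l(1)] by (simp add: powr_def)
  also have "\<dots> \<le> nest_sum p l powr \<mu> l"
    using \<mu>[OF l(1)] l(2)
    by (intro powr_mono2 member_le_sum) auto
  also have "\<dots> \<le> nest_total p" using l(1) by (intro member_le_sum) auto
  finally show ?thesis
    unfolding nested_logit_surplus_def using nest_total_pos by (simp add: ln_ge_iff)
qed

text \<open>Averages the bounds for single products; the result is affine in \<open>p\<close>, as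
  the coercivity argument requires.\<close>

lemma nested_logit_surplus_ge_average:
  assumes "q \<in> prob_simplex"
  shows "q \<bullet> (a - p) \<le> nested_logit_surplus a L nest \<mu> p"
proof -
  have q: "0 \<le> q $ i" "(\<Sum>i\<in>UNIV. q $ i) = 1" for i
    using assms by (auto simp: prob_simplex_def less_eq_vec_def)
  have "q \<bullet> (a - p) \<le> (\<Sum>i\<in>UNIV. q $ i * nested_logit_surplus a L nest \<mu> p)"
    unfolding inner_vec_def inner_real_def
    by (intro sum_mono mult_left_mono) (auto simp: nested_logit_surplus_ge q)
  also have "\<dots> = nested_logit_surplus a L nest \<mu> p"
    by (simp add: q flip: sum_distrib_right)
  finally show ?thesis .
qed

text \<open>Only existence of the derivative is recorded; its value is later identified through a
  subgradient.\<close>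

lemma nested_logit_surplus_differentiable:
  "nested_logit_surplus a L nest \<mu> differentiable (at p)"
proof -
  have "((\<lambda>p. nest_sum p l) has_derivative
      (\<lambda>h. \<Sum>i\<in>nest l. exp ((a $ i - p $ i) / \<mu> l) * (- h $ i / \<mu> l))) (at p)"
    if "l \<in> {1..L}" for l
    using \<mu>[OF that] by (auto intro!: derivative_eq_intros bounded_linear.has_derivative[OF bounded_linear_vec_nth]
        simp: fun_eq_iff mult.commute)
  then have "(\<lambda>p. nest_sum p l powr \<mu> l) differentiable (at p)" if "l \<in> {1..L}" for l
    using has_derivative_powr[where g = "\<lambda>p. nest_sum p l" and f = "\<lambda>_. \<mu> l" and X = UNIV,
        OF _ has_derivative_const nest_sum_pos[OF that]] that
    by (auto intro!: differentiableI)
  then have "nest_total differentiable (at p)"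
    by (intro differentiable_sum) auto
  then obtain D where "(nest_total has_derivative D) (at p)"
    by (auto simp: differentiable_def)
  from has_derivative_ln[where g = nest_total, OF nest_total_pos this] show ?thesis
    unfolding nested_logit_surplus_def[abs_def] by (rule differentiableI)
qed

text \<open>The choice probability of \<open>i\<close> in nest \<open>l\<close> is the product of the nest probability \<open>P l\<close> and
  the conditional probability \<open>c l i\<close>; the bound is Jensen's inequality for \<open>ln\<close>, applied first
  across and then within nests.\<close>
lemma nested_logit_surplus_has_subgradient:
  "\<exists>g. \<forall>q. nested_logit_surplus a L nest \<mu> q \<ge> nested_logit_surplus a L nest \<mu> p + g \<bullet> (q - p)"
proof -
  define P where "P l = nest_sum p l powr \<mu> l / nest_total p" for l
  define c where "c l i = exp ((a $ i - p $ i) / \<mu> l) / nest_sum p l" for l i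
  \<comment> \<open>Minus the choice probabilities. Summing over all nests with an indicator avoids
    selecting the nest of \<open>i\<close> and lets the two sums be swapped.\<close>
  define g where "g = (\<chi> i. - (\<Sum>l=1..L. if i \<in> nest l then P l * c l i else 0))"
  have P: "0 \<le> P l" for l unfolding P_def by (intro divide_nonneg_nonneg sum_nonneg) auto
  have P1: "(\<Sum>l=1..L. P l) = 1"
    unfolding P_def using nest_total_pos[of p] by (simp flip: sum_divide_distrib)
  have c: "0 \<le> c l i" for l i unfolding c_def by (intro divide_nonneg_nonneg sum_nonneg) auto
  have c1: "(\<Sum>i\<in>nest l. c l i) = 1" if "l \<in> {1..L}" for l
    unfolding c_def using nest_sum_pos[OF that, of p] by (simp flip: sum_divide_distrib)
  have "nested_logit_surplus a L nest \<mu> q \<ge> nested_logit_surplus a L nest \<mu> p + g \<bullet> (q - p)" for q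
  proof -
    let ?r = "\<lambda>l. nest_sum q l / nest_sum p l"
    \<comment> \<open>Reweighting the price changes by \<open>c l i\<close> turns the sum of
      exponentials into the ratio of the nest sums at \<open>q\<close> and \<open>p\<close>.\<close>
    have within: "(\<Sum>i\<in>nest l. c l i * (p $ i - q $ i)) \<le> \<mu> l * ln (?r l)" if l: "l \<in> {1..L}" for l
    proof -
      have "(\<Sum>i\<in>nest l. c l i * ln (exp ((p $ i - q $ i) / \<mu> l)))
          \<le> ln (\<Sum>i\<in>nest l. c l i * exp ((p $ i - q $ i) / \<mu> l))"
        using c c1[OF l] by (intro ln_weighted_sum_ge) auto
      also have "(\<Sum>i\<in>nest l. c l i * exp ((p $ i - q $ i) / \<mu> l)) = ?r l"
        unfolding c_def sum_divide_distrib
        by (intro sum.cong refl) (simp add: mult_exp_exp diff_divide_distrib)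
      finally have "(\<Sum>i\<in>nest l. c l i * (p $ i - q $ i)) / \<mu> l \<le> ln (?r l)"
        by (simp add: sum_divide_distrib)
      then show ?thesis using \<mu>[OF l] by (simp add: field_simps)
    qed
    have "g \<bullet> (q - p) = (\<Sum>i\<in>UNIV. \<Sum>l=1..L. if i \<in> nest l then P l * c l i * (p $ i - q $ i) else 0)"
      unfolding g_def inner_vec_def inner_real_def vec_lambda_beta sum_negf[symmetric] sum_distrib_right
      by (intro sum.cong refl) (simp add: algebra_simps)
    also have "\<dots> = (\<Sum>l=1..L. \<Sum>i\<in>UNIV. if i \<in> nest l then P l * c l i * (p $ i - q $ i) else 0)"
      by (rule sum.swap)
    also have "\<dots> = (\<Sum>l=1..L. P l * (\<Sum>i\<in>nest l. c l i * (p $ i - q $ i)))"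
      by (simp add: sum.If_cases sum_distrib_left mult.assoc)
    also have "\<dots> \<le> (\<Sum>l=1..L. P l * ln (?r l powr \<mu> l))"
      using within P nest_sum_pos by (intro sum_mono mult_left_mono) (auto simp: ln_powr)
    also have "\<dots> \<le> ln (\<Sum>l=1..L. P l * ?r l powr \<mu> l)"
      using P P1 nest_sum_pos[of _ p] nest_sum_pos[of _ q]
      by (intro ln_weighted_sum_ge) (fastforce simp: less_imp_neq[THEN not_sym])+
    \<comment> \<open>The numerator of \<open>P l\<close> cancels the denominator of the ratio
      raised to \<open>\<mu> l\<close>.\<close>
    also have "(\<Sum>l=1..L. P l * ?r l powr \<mu> l) = nest_total q / nest_total p"
      unfolding sum_divide_distrib[where A = "{1..L}"]
    proof (intro sum.cong refl)
      fix l assume l: "l \<in> {1..L}"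
      show "P l * ?r l powr \<mu> l = nest_sum q l powr \<mu> l / nest_total p"
        using nest_sum_pos[OF l, of p] nest_sum_pos[OF l, of q]
        by (simp add: P_def powr_divide less_imp_le)
    qed
    also have "ln \<dots> = nested_logit_surplus a L nest \<mu> q - nested_logit_surplus a L nest \<mu> p"
      unfolding nested_logit_surplus_def using nest_total_pos[of p] nest_total_pos[of q] by (simp add: ln_div)
    finally show ?thesis by simp
  qed
  then show ?thesis by blast
qed

text \<open>Any subgradient equals the gradient by differentiability, so \<open>demand\<close>
  inherits the subgradient inequality.\<close>

lemma
  defines "E \<equiv> nested_logit_surplus a L nest \<mu>"
  shows nested_logit_surplus_gderiv: "GDERIV E p :> - demand E p"
    and nested_logit_surplus_subgradient: "E q \<ge> E p + (- demand E p) \<bullet> (q - p)"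
proof -
  obtain g where g: "\<And>q. E q \<ge> E p + g \<bullet> (q - p)"
    using nested_logit_surplus_has_subgradient[of p] unfolding E_def by blast
  have gd: "GDERIV E p :> g"
    using nested_logit_surplus_differentiable g unfolding E_def by (intro gderiv_of_subgradient)
  then have "- demand E p = g" by (simp add: demand_def gradient_eq)
  with gd g show "GDERIV E p :> - demand E p" and "E q \<ge> E p + (- demand E p) \<bullet> (q - p)"
    by simp_all
qed

end

section \<open>Equilibrium as optimality, and existence of a minimizer\<close>

theorem theorem3p6:
  fixes K J :: nat
    and Y :: "nat \<Rightarrow> (real^'n) set"
    and chat :: "nat \<Rightarrow> real^'n \<Rightarrow> real"
    and \<Gamma> :: "nat \<Rightarrow> real"
    and yhat ybar :: "nat \<Rightarrow> real^'n"
    and \<N> :: "nat \<Rightarrow> real"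
    and a qbar :: "nat \<Rightarrow> real^'n"
    and L :: "nat \<Rightarrow> nat"
    and nest :: "nat \<Rightarrow> nat \<Rightarrow> 'n set"
    and \<mu> :: "nat \<Rightarrow> nat \<Rightarrow> real"
  assumes "\<And>k. k \<in> {1..K} \<Longrightarrow> closed (Y k)"
    and "\<And>k. k \<in> {1..K} \<Longrightarrow> convex (Y k)"
    and "\<And>k. k \<in> {1..K} \<Longrightarrow> convex_on UNIV (chat k)"
    and "\<And>k. k \<in> {1..K} \<Longrightarrow> 0 < \<Gamma> k"
    and "\<And>j. j \<in> {1..J} \<Longrightarrow> 0 < \<N> j"
    and "\<And>j. j \<in> {1..J} \<Longrightarrow> nest_partition (L j) (nest j)"
    and "\<And>j l. j \<in> {1..J} \<Longrightarrow> l \<in> {1..L j} \<Longrightarrow> 0 < \<mu> j l \<and> \<mu> j l \<le> 1"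
    and "\<And>k. k \<in> {1..K} \<Longrightarrow> ybar k \<in> Y k"
    and "\<And>j. j \<in> {1..J} \<Longrightarrow> qbar j \<in> prob_simplex"
    and "\<And>i. (\<Sum>k=1..K. ybar k) $ i > (\<Sum>j=1..J. \<N> j *\<^sub>R qbar j) $ i"
  shows "let c = (\<lambda>k. supplier_cost (chat k) (\<Gamma> k) (yhat k));
             E = (\<lambda>j. nested_logit_surplus (a j) (L j) (nest j) (\<mu> j));
             solutions = {p. is_arg_min (TER K Y c J \<N> E) (\<lambda>p. 0 \<le> p) p}
         in solutions \<noteq> {} \<and> solutions = {p. equilibrium_price K Y c J \<N> E p}"
proof -
  define c where "c k = supplier_cost (chat k) (\<Gamma> k) (yhat k)" for k
  define E where "E j = nested_logit_surplus (a j) (L j) (nest j) (\<mu> j)" for j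
  let ?T = "TER K Y c J \<N> E"
  let ?g = "excess_supply K Y c J \<N> E"
  note Y = assms(1,2) and chat = assms(3) and \<Gamma> = assms(4) and ybar = assms(8)
  have Yne: "Y k \<noteq> {}" if "k \<in> {1..K}" for k using ybar[OF that] by auto
  have \<mu>: "l \<in> {1..L j} \<Longrightarrow> 0 < \<mu> j l" if "j \<in> {1..J}" for j l using assms(7)[OF that] by blast
  \<comment> \<open>Moving the sign onto each demand matches the gradients of the surpluses term by
    term.\<close>
  have g_eq: "?g p = (\<Sum>k=1..K. optimal_supply (Y k) (c k) p) + (\<Sum>j=1..J. \<N> j *\<^sub>R (- demand (E j) p))" for p
    by (simp add: excess_supply_def sum_negf)
  have gd: "GDERIV ?T p :> ?g p" for p
    unfolding TER_def[abs_def] g_eq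
    by (intro GDERIV_add gderiv_sum gderiv_cmult)
      (auto simp only: c_def E_def intro!: profit_gderiv nested_logit_surplus_gderiv
         Y Yne chat \<Gamma> assms(6) \<mu>)
  have sub: "?T q \<ge> ?T p + ?g p \<bullet> (q - p)" for p q
  proof -
    have "?T p + ?g p \<bullet> (q - p)
      = (\<Sum>k=1..K. profit (Y k) (c k) p + optimal_supply (Y k) (c k) p \<bullet> (q - p))
        + (\<Sum>j=1..J. \<N> j * (E j p + (- demand (E j) p) \<bullet> (q - p)))"
      unfolding TER_def g_eq
      by (simp add: inner_add_left inner_sum_left sum.distrib sum_negf sum_subtractf algebra_simps)
    also have "\<dots> \<le> ?T q"
      unfolding TER_def c_def E_def
      by (intro add_mono sum_mono mult_left_mono profit_subgradient nested_logit_surplus_subgradient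
          Y Yne chat \<Gamma> assms(6) \<mu> less_imp_le[OF assms(5)])
    finally show ?thesis .
  qed
  have "is_arg_min ?T (\<lambda>p. 0 \<le> p) p \<longleftrightarrow> equilibrium_price K Y c J \<N> E p" for p
    using arg_min_nonneg_orthant_iff[OF gd sub] by (simp add: equilibrium_price_def)
  moreover have "\<exists>p. is_arg_min ?T (\<lambda>p. 0 \<le> p) p"
  proof (rule arg_min_nonneg_orthant_exists)
    show "continuous_on UNIV ?T"
      using gderiv_continuous[OF gd] by (simp add: continuous_on_eq_continuous_at)
    \<comment> \<open>The slope is the slack of the strict feasibility assumption, hence positive in
      each coordinate.\<close>
    let ?v = "(\<Sum>k=1..K. ybar k) - (\<Sum>j=1..J. \<N> j *\<^sub>R qbar j)"
    show "0 < ?v $ i" for i using assms(10)[of i] by simp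
    fix p
    \<comment> \<open>Collects the price-independent parts of the bounds obtained from the test
      points: costs minus mean observable utilities.\<close>
    let ?C = "(\<Sum>k=1..K. c k (ybar k)) - (\<Sum>j=1..J. \<N> j * (qbar j \<bullet> a j))"
    have "p \<bullet> ?v - ?C = (\<Sum>k=1..K. p \<bullet> ybar k - c k (ybar k)) + (\<Sum>j=1..J. \<N> j * (qbar j \<bullet> (a j - p)))"
      by (simp add: inner_diff_right inner_sum_right sum_subtractf right_diff_distrib inner_commute)
    also have "\<dots> \<le> ?T p"
      unfolding TER_def c_def E_def
      by (intro add_mono sum_mono mult_left_mono profit_ge nested_logit_surplus_ge_average
          Y chat \<Gamma> ybar assms(6,9) \<mu> less_imp_le[OF assms(5)])
    finally show "p \<bullet> ?v - ?C \<le> ?T p" .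
  qed
  ultimately show ?thesis
    unfolding Let_def c_def[abs_def] E_def[abs_def] by auto
qed

end
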